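(* Let $p$ be a prime number, let $P=X^{p+1}-X^p\in\mathbb{F}_p[X]$, and let $d=\deg P=p+1$. Then $P$ is not a $d$th power, but $P$ has a non-trivial common factor (i.e. a common factor of positive degree) with each of its Hasse derivatives $P_i$, $i=1,2,\ldots,d-1$.
   Context: For $P=a_0X^d+a_1X^{d-1}+\cdots+a_d$ over a field, the $i$th Hasse derivative is $P_i=\sum_{j=i}^{d}\binom{j}{i}a_{d-j}X^{j-i}$. If $P_i=0$, then $\gcd(P,P_i)=P$. *)

theory Defs
  imports "Berlekamp_Zassenhaus.Finite_Field" "HOL-Computational_Algebra.Polynomial"
begin

text \<open>
  The prime field with \<open>p\<close> elements is \<open>'p mod_ring\<close> (integers modulo \<open>CARD('p)\<close>), where
  the class \<open>prime_card\<close> says that \<open>CARD('p)\<close> is prime.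
\<close>

text \<open>
  For \<open>P = a\<^sub>0 X^d + \<dots> + a\<^sub>d\<close> one has \<open>coeff P j = a\<^bsub>d - j\<^esub>\<close>.
\<close>

definition hasse_deriv :: "nat \<Rightarrow> 'a :: comm_semiring_1 poly \<Rightarrow> 'a poly" where
  "hasse_deriv i P = (\<Sum>j = i..degree P. monom (of_nat (j choose i) * coeff P j) (j - i))"

end

theory Submission
  imports Defs
begin

text \<open>
  For \<open>0 < i < p\<close> the prime \<open>p\<close> divides \<open>p choose i\<close>, so \<open>P\<^sub>i\<close> is a multiple of
  \<open>X\<^bsup>p+1-i\<^esup>\<close> and shares the factor \<open>X\<close> with \<open>P\<close>; and \<open>P\<^sub>p = X - 1\<close>. Were \<open>P\<close> a \<open>d\<close>th power
  with \<open>d > 1\<close>, its root \<open>1\<close> would be a multiple root, contradicting \<open>P'(1) = 1\<close>.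
\<close>

text \<open>For \<open>j \<ge> i\<close> distinct \<open>j\<close> give distinct exponents
  \<open>j - i\<close>, so at most one summand contributes; past \<open>degree P\<close> the
  coefficient is zero anyway. The degree thus disappears from the formula, and linearity becomes
  evident.\<close>

lemma coeff_hasse_deriv:
  "coeff (hasse_deriv i P) n = of_nat ((n + i) choose i) * coeff P (n + i)"
proof -
  have "coeff (hasse_deriv i P) n =
      (\<Sum>j = i..degree P. if j = n + i then of_nat (j choose i) * coeff P j else 0)"
    unfolding hasse_deriv_def coeff_sum by (rule sum.cong) auto
  also have "\<dots> = of_nat ((n + i) choose i) * coeff P (n + i)"
    by (auto simp: coeff_eq_0)
  finally show ?thesis .
qed

lemma hasse_deriv_diff:
  fixes P Q :: "'a :: comm_ring_1 poly"
  shows "hasse_deriv i (P - Q) = hasse_deriv i P - hasse_deriv i Q"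
  by (rule poly_eqI) (simp add: coeff_hasse_deriv algebra_simps)

text \<open>For \<open>n < i\<close> the truncated exponent \<open>n - i\<close> is harmless: the
  binomial coefficient is zero.\<close>

lemma hasse_deriv_monom:
  "hasse_deriv i (monom c n) = monom (of_nat (n choose i) * c) (n - i)"
  by (rule poly_eqI) (auto simp: coeff_hasse_deriv binomial_eq_0)

lemma of_nat_eq_0_mod_ring_if_dvd:
  assumes "CARD('p :: nontriv) dvd n"
  shows "(of_nat n :: 'p mod_ring) = 0"
  using assms by (auto elim!: dvdE simp: of_nat_card_eq_0)

lemma poly_pderiv_power_eq_0:
  fixes Q :: "'a :: idom poly"
  assumes "n > 1" and "poly (Q ^ n) x = 0"
  shows "poly (pderiv (Q ^ n)) x = 0"
  using assms by (simp add: pderiv_power)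

theorem proposition3p1:
  fixes p d :: nat and P :: "'p :: prime_card mod_ring poly"
  assumes "prime p" and "CARD('p) = p"
    and "P = monom 1 (p + 1) - monom 1 p"
    and "d = degree P"
  shows "d = p + 1 \<and>
    \<not> (\<exists>Q :: 'p mod_ring poly. P = Q ^ d) \<and>
    (\<forall>i \<in> {1..d - 1}. \<exists>F :: 'p mod_ring poly. degree F > 0 \<and> F dvd P \<and> F dvd hasse_deriv i P)"
proof (intro conjI ballI)
  have p: "p > 1"
    using assms(1) by (rule prime_gt_1_nat)
  have p_0: "(of_nat p :: 'p mod_ring) = 0"
    using assms(2) by (intro of_nat_eq_0_mod_ring_if_dvd) simp
  \<comment> \<open>This factorization yields the degree, the root 1 and the two common factors X
    and X - 1.\<close>
  have P_eq: "P = monom 1 p * [:-1, 1:]"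
    unfolding assms(3) by (simp add: monom_Suc algebra_simps)
  show d: "d = p + 1"
    unfolding assms(4) P_eq by (subst degree_mult_eq) (auto simp: degree_monom_eq)
  show "\<not> (\<exists>Q. P = Q ^ d)"
  proof
    assume "\<exists>Q. P = Q ^ d"
    then obtain Q where Q: "P = Q ^ d" by blast
    have "poly P 1 = 0"
      unfolding P_eq by simp
    then have "poly (pderiv P) 1 = 0"
      using p unfolding Q d by (intro poly_pderiv_power_eq_0) auto
    \<comment> \<open>In characteristic \<open>p\<close> the derivative (p + 1) X^p - p X^(p-1) is
      just X^p.\<close>
    moreover have "poly (pderiv P) 1 = 1"
      unfolding assms(3) by (simp add: pderiv_diff pderiv_monom poly_monom p_0)
    ultimately show False by simp
  qed
  fix i assume "i \<in> {1..d - 1}"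
  then have i: "1 \<le> i" "i \<le> p" by (auto simp: d)
  have hasse: "hasse_deriv i P =
      monom (of_nat ((p + 1) choose i)) (p + 1 - i) - monom (of_nat (p choose i)) (p - i)"
    unfolding assms(3) by (simp add: hasse_deriv_diff hasse_deriv_monom)
  show "\<exists>F. degree F > 0 \<and> F dvd P \<and> F dvd hasse_deriv i P"
  proof (cases "i = p")
    case True
    \<comment> \<open>The coefficient of X is p + 1, which is 1 in the field.\<close>
    have "hasse_deriv p P = [:-1, 1:]"
      using hasse[unfolded True] by (simp add: p_0 monom_Suc monom_0)
    moreover have "[:-1, 1:] dvd P"
      unfolding P_eq by (rule dvd_triv_right)
    ultimately show ?thesis
      unfolding True by (intro exI[of _ "[:-1, 1:]"]) simp
  next
    case False
    have "(of_nat (p choose i) :: 'p mod_ring) = 0"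
      using i False assms(1,2)
      by (intro of_nat_eq_0_mod_ring_if_dvd) (auto intro!: dvd_choose_prime)
    \<comment> \<open>Only the term of exponent \<open>p + 1 - i\<close> can survive, and this
      exponent is positive.\<close>
    then have "monom 1 1 dvd hasse_deriv i P"
      unfolding hasse using i by (simp add: monom_1_dvd_iff')
    moreover have "monom 1 1 dvd P"
      unfolding P_eq using p by (intro dvd_mult2) (simp add: monom_1_dvd_iff')
    ultimately show ?thesis
      by (intro exI[of _ "monom 1 1"]) (simp add: degree_monom_eq)
  qed
qed

end
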